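(* Let $G=(V,E)$ be a finite directed graph with nonnegative edge distances $d_e$ and losses $l_e$, source $s$ and destination $t$, and for an $s$-$t$ path $P$ let $d(P)=\sum_{e\in P}d_e$, $l(P)=\sum_{e\in P}l_e$, assumed to satisfy $d(P)>0$. Let $\kappa=\frac{20}{\ln 10}$ and $f(P)=l(P)+\kappa\ln d(P)$, and let $(d^*,l^* )$ be the distance-loss pair of a dominant $s$-$t$ path (one minimizing $f$). Fix $r>1$ and $\lambda_0>0$ and set $\lambda_i=\lambda_0 r^i$ for $i\in\mathbb{Z}$. The geometric progression algorithm $\mathrm{GP}_{r,\lambda_0}$ computes, for each $i$, an $s$-$t$ path $P_i$ minimizing $l(P)+\lambda_i d(P)$, and outputs the path among the $P_i$ with smallest $f$. Then the output path $P$ satisfies $$f(P)\le l^*+\kappa\ln d^*+\kappa\left(-1+\frac{\ln r}{r-1}+\ln(r-1)-\ln\ln r\right).$$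
   Context: In the application (indoor dominant path model), $f$ is the modeled path loss in dB up to an additive constant, with $d$ Euclidean path length and $l$ total penetration plus diffraction loss; $\kappa\approx 8.686$ dB. Only finitely many distinct paths exist, so the minimum over the $P_i$ is attained. *)

theory Defs
  imports Complex_Main "Graph_Theory.Graph_Theory"
begin

definition kappa :: real
  where "kappa = 20 / ln 10"

definition path_loss :: "('e \<Rightarrow> real) \<Rightarrow> ('e \<Rightarrow> real) \<Rightarrow> 'e awalk \<Rightarrow> real"
  where "path_loss d l P = wf_digraph.awalk_cost l P + kappa * ln (wf_digraph.awalk_cost d P)"

definition dominant_path ::
    "('v, 'e) pre_digraph \<Rightarrow> ('e \<Rightarrow> real) \<Rightarrow> ('e \<Rightarrow> real) \<Rightarrow> 'v \<Rightarrow> 'v \<Rightarrow> 'e awalk \<Rightarrow> bool"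
  where "dominant_path G d l s t P \<longleftrightarrow>
    is_arg_min (path_loss d l) (\<lambda>Q. pre_digraph.apath G s Q t) P"

text \<open>
  The algorithm does not prescribe how ties are broken, neither among the minimizers for a given
  \<open>i\<close> nor in the final selection, so it is modelled as the relation that holds of every
  path \<open>P\<close> it may output.
\<close>

definition gp_output ::
    "('v, 'e) pre_digraph \<Rightarrow> ('e \<Rightarrow> real) \<Rightarrow> ('e \<Rightarrow> real) \<Rightarrow> 'v \<Rightarrow> 'v \<Rightarrow> real \<Rightarrow> real \<Rightarrow> 'e awalk \<Rightarrow> bool"
  where "gp_output G d l s t r lam0 P \<longleftrightarrow>
    (\<exists>Ps :: int \<Rightarrow> 'e awalk.
      (\<forall>i. is_arg_min
             (\<lambda>Q. wf_digraph.awalk_cost l Q + (lam0 * r powi i) * wf_digraph.awalk_cost d Q)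
             (\<lambda>Q. pre_digraph.apath G s Q t) (Ps i)) \<and>
      is_arg_min (path_loss d l) (\<lambda>Q. Q \<in> range Ps) P)"

end

theory Submission
  imports Defs "HOL-Analysis.Convex"
begin

text \<open>
  Minimality of \<open>P\<^sub>i\<close> against the dominant path, together with the maximum of
  \<open>\<kappa> ln x - \<lambda>\<^sub>i x\<close> over \<open>x > 0\<close>, bounds the excess of
  \<open>f(P\<^sub>i)\<close> by \<open>\<kappa> (y - 1 - ln y)\<close> where \<open>y = \<lambda>\<^sub>i d\<^sup>* / \<kappa>\<close>.
  The geometric progression meets every interval \<open>[a, r a]\<close>; for \<open>a = ln r / (r - 1)\<close>
  the convex function \<open>y - 1 - ln y\<close> takes the same value at both endpoints, and that value is
  the claimed bound.
\<close>

text \<open>The exponent is \<open>log r (a / c)\<close> rounded up; rounding adds less than 1,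
  which costs at most one factor \<open>r\<close>.\<close>

lemma power_int_progression_meets_interval:
  fixes r c a :: real
  assumes "r > 1" "c > 0" "a > 0"
  obtains i :: int where "a \<le> c * r powi i" "c * r powi i \<le> r * a"
proof
  define i where "i = \<lceil>log r (a / c)\<rceil>"
  have pow: "r powi i = r powr real_of_int i"
    using assms by (simp add: powr_real_of_int')
  have eq: "r powr log r (a / c) = a / c"
    using assms by simp
  have "a / c \<le> r powi i"
    unfolding pow using assms powr_mono[of "log r (a / c)" "real_of_int i" r]
    by (simp add: eq i_def)
  then show "a \<le> c * r powi i"
    using assms by (simp add: field_simps)
  have "r powi i \<le> r powr (log r (a / c) + 1)"
    unfolding pow using assms by (intro powr_mono) (simp_all add: i_def)
  also have "\<dots> = (a / c) * r"
    using assms by (simp only: powr_add eq) simp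
  finally show "c * r powi i \<le> r * a"
    using assms by (simp add: field_simps)
qed

lemma ln_ge_chord:
  fixes a b x :: real
  assumes "0 < a" "a \<le> x" "x \<le> b"
  shows "ln a + (ln b - ln a) / (b - a) * (x - a) \<le> ln x"
proof -
  have "concave_on {a..b} ln"
    using ln_concave assms unfolding concave_on_def by (auto intro: convex_on_subset)
  from concave_onD_Icc'[OF this] assms show ?thesis
    by (auto simp: add.commute)
qed

text \<open>This is \<open>ln z \<le> z - 1\<close> at \<open>z = x * m / k\<close>, scaled by
  \<open>k\<close>; the maximizer is \<open>x = k / m\<close>.\<close>

lemma ln_minus_linear_le:
  fixes k m x :: real
  assumes "k > 0" "m > 0" "x > 0"
  shows "k * ln x - m * x \<le> k * ln (k / m) - k"
proof -
  have "ln (x * m / k) \<le> x * m / k - 1"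
    using assms by (intro ln_le_minus_one) simp
  then have "k * ln (x * m / k) \<le> k * (x * m / k - 1)"
    using assms by (intro mult_left_mono) auto
  then show ?thesis
    using assms by (simp add: ln_mult ln_div algebra_simps)
qed

lemma kappa_pos: "kappa > 0"
  by (simp add: kappa_def)

theorem theorem4:
  fixes G :: "('v, 'e) pre_digraph"
    and d l :: "'e \<Rightarrow> real"
    and s t :: 'v
    and r lam0 dstar lstar :: real
    and Pstar P :: "'e awalk"
  assumes "fin_digraph G"
    and "s \<in> verts G" and "t \<in> verts G"
    and "\<And>e. e \<in> arcs G \<Longrightarrow> d e \<ge> 0"
    and "\<And>e. e \<in> arcs G \<Longrightarrow> l e \<ge> 0"
    and "\<And>Q. pre_digraph.apath G s Q t \<Longrightarrow> wf_digraph.awalk_cost d Q > 0"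
    and "dominant_path G d l s t Pstar"
    and "dstar = wf_digraph.awalk_cost d Pstar"
    and "lstar = wf_digraph.awalk_cost l Pstar"
    and "r > 1" and "lam0 > 0"
    and "gp_output G d l s t r lam0 P"
  shows "path_loss d l P \<le> lstar + kappa * ln dstar
           + kappa * (- 1 + ln r / (r - 1) + ln (r - 1) - ln (ln r))"
proof -
  have star: "pre_digraph.apath G s Pstar t"
    using assms(7) by (simp add: dominant_path_def is_arg_min_def)
  then have dstar: "dstar > 0"
    using assms(6,8) by simp
  obtain Ps where Ps: "\<And>i. is_arg_min
      (\<lambda>Q. wf_digraph.awalk_cost l Q + (lam0 * r powi i) * wf_digraph.awalk_cost d Q)
      (\<lambda>Q. pre_digraph.apath G s Q t) (Ps i)"
    and P: "is_arg_min (path_loss d l) (\<lambda>Q. Q \<in> range Ps) P"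
    using assms(12) unfolding gp_output_def by blast
  define a where "a = ln r / (r - 1)"
  have a: "a > 0"
    using \<open>r > 1\<close> by (simp add: a_def)
  have "r * a - a = (r - 1) * a"
    by (simp add: algebra_simps)
  then have ra: "r * a - a = ln r"
    using \<open>r > 1\<close> by (simp add: a_def)
  \<comment> \<open>The index depends on the unknown \<open>dstar\<close>, which is harmless since
    \<open>P\<close> is at least as good as every \<open>Ps i\<close>.\<close>
  obtain i where i: "a \<le> lam0 * dstar / kappa * r powi i" "lam0 * dstar / kappa * r powi i \<le> r * a"
    using power_int_progression_meets_interval[of r "lam0 * dstar / kappa" a]
      \<open>r > 1\<close> \<open>lam0 > 0\<close> dstar kappa_pos a by auto
  define m where "m = lam0 * r powi i"
  define y where "y = m * dstar / kappa"
  have m: "m > 0"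
    using \<open>r > 1\<close> \<open>lam0 > 0\<close> by (simp add: m_def)
  have y: "a \<le> y" "y \<le> r * a"
    using i by (simp_all add: y_def m_def ac_simps)
  have "ln a + (ln (r * a) - ln a) / (r * a - a) * (y - a) \<le> ln y"
    using a \<open>r > 1\<close> y by (intro ln_ge_chord) auto
  \<comment> \<open>The chord has slope 1, because
    \<open>ln (r * a) - ln a = ln r = r * a - a\<close> by the choice of \<open>a\<close>.\<close>
  then have chord: "y - ln y \<le> a - ln a"
    using a ra \<open>r > 1\<close> by (simp add: ln_mult)
  define di li where "di = wf_digraph.awalk_cost d (Ps i)" and "li = wf_digraph.awalk_cost l (Ps i)"
  have di: "di > 0"
    using Ps[of i] assms(6) by (simp add: is_arg_min_def di_def)
  have opt: "li + m * di \<le> lstar + m * dstar"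
    using Ps[of i] star unfolding is_arg_min_linorder
    by (simp add: assms(8,9) m_def di_def li_def)
  have "path_loss d l P \<le> path_loss d l (Ps i)"
    using P unfolding is_arg_min_linorder by blast
  also have "\<dots> = li + kappa * ln di"
    by (simp add: path_loss_def di_def li_def)
  \<comment> \<open>\<open>opt\<close> bounds \<open>li\<close> at the price of
    \<open>- m * di\<close>; maximizing \<open>kappa * ln di - m * di\<close> then eliminates the
    unknown \<open>di\<close>.\<close>
  also have "\<dots> \<le> lstar + m * dstar + (kappa * ln (kappa / m) - kappa)"
    using opt ln_minus_linear_le[OF kappa_pos m di] by linarith
  \<comment> \<open>Here \<open>m * dstar = kappa * y\<close> and
    \<open>kappa / m = dstar / y\<close>.\<close>
  also have "\<dots> = lstar + kappa * ln dstar + kappa * (y - ln y - 1)"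
    using m kappa_pos dstar by (simp add: y_def ln_div ln_mult algebra_simps)
  also have "\<dots> \<le> lstar + kappa * ln dstar + kappa * (a - ln a - 1)"
    using chord kappa_pos by simp
  also have "a - ln a - 1 = - 1 + ln r / (r - 1) + ln (r - 1) - ln (ln r)"
    using \<open>r > 1\<close> by (simp add: a_def ln_div)
  finally show ?thesis .
qed

end
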